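(* Let $\langle N, \underline{\mathcal{A}}, \Theta, \underline{U}\rangle$ be a finite game with uncertainty. Then there exists a complete strategy profile $\underline{\rho}^* = (\underline{\sigma}^*;\underline{\pi}^* ) \in \mathcal{R}$ that is an extended equilibrium of the game.
   Context: **Game with uncertainty.** A (finite, $N$-person, non-cooperative) game with (global) uncertainty is a tuple $\langle N, \underline{\mathcal{A}}, \Theta, \underline{U}\rangle$ where $N\ge 1$ is an integer (the number of players); $\underline{\mathcal{A}} = (\mathcal{A}_1,\dots,\mathcal{A}_N)$ with every $\mathcal{A}_i$ a finite nonempty set (actions of player $i$); $\Theta$ is a finite nonempty set (values of the unknown parameter); and $\underline{U}=(U_1,\dots,U_N)$ with $U_i:\mathcal{A}_1\times\dots\times\mathcal{A}_N\times\Theta\to\mathbb{R}$ an arbitrary function (utility of player $i$). We write $\underline{a}\in\underline{\mathcal{A}}$ for $\underline{a}=(a_1,\dots,a_N)\in\mathcal{A}_1\times\dots\times\mathcal{A}_N$, and $\underline{b}^{[i]\leftarrow a_i}$ for the tuple obtained from $\underline{b}$ by replacing its $i$-th entry by $a_i$. **Profiles.** For a finite set $S$, $\Delta(S)=\{p:S\to[0,1] \mid \sum_{s\in S}p(s)=1\}$. A complete strategy profile is $\underline{\rho}=(\underline{\sigma};\underline{\pi})$ with $\underline{\sigma}=(\sigma_1,\dots,\sigma_N)$, $\sigma_i\in\Delta(\mathcal{A}_i)$ (mixed strategies), and $\underline{\pi}=(\pi_1,\dots,\pi_N)$, $\pi_i\in\Delta(\Theta)$ (subjective priors). The set of complete strategy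 profiles is $\mathcal{R}=\left(\prod_{i=1}^N\Delta(\mathcal{A}_i)\right)\times\Delta(\Theta)^N$. **Probabilities.** $\Pi(\underline{a}|\underline{\sigma})=\prod_{j=1}^N\sigma_j(a_j)$ and $\Pi_i(\underline{a};\theta|\underline{\sigma};\underline{\pi})=\left(\prod_{j=1}^N\sigma_j(a_j)\right)\pi_i(\theta)$. **Personal regret.** $$R_i(\underline{a};\theta|\underline{\sigma})=\max_{c_i\in\mathcal{A}_i}\Big(\sum_{\underline{b}\in\underline{\mathcal{A}}}U_i(\underline{b}^{[i]\leftarrow c_i};\theta)\,\Pi(\underline{b}|\underline{\sigma})\Big)-U_i(\underline{a};\theta).$$ **Expected utilities and regrets.** $$\mathrm{EU}_i(\underline{\sigma};\underline{\pi})=\sum_{\underline{a}\in\underline{\mathcal{A}},\,\theta\in\Theta}U_i(\underline{a};\theta)\,\Pi_i(\underline{a};\theta|\underline{\sigma};\underline{\pi}),\qquad \mathrm{EU}_i(a_i|\underline{\sigma};\underline{\pi})=\sum_{\underline{b}\in\underline{\mathcal{A}},\,\theta\in\Theta}U_i(\underline{b}^{[i]\leftarrow a_i};\theta)\,\Pi_i(\underline{b};\theta|\underline{\sigma};\underline{\pi}),$$ $$\mathrm{ER}_i(\underline{\sigma};\underline{\pi})=\sum_{\underline{a}\in\underline{\mathcal{A}},\,\theta\in\Theta}R_i(\underline{a};\theta|\underline{\sigma})\,\Pi_i(\underline{a};\theta|\underline{\sigma};\underline{\pi}),\qquad \mathrm{ER}_i(\theta|\underline{\sigma};\underline{\pi})=\sum_{\underline{a}\in\underline{\mathcal{A}}}R_i(\underline{a};\theta|\underline{\sigma})\,\Pi(\underline{a}|\underline{\sigma}).$$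 **Extended equilibrium.** $(\underline{\sigma}^*;\underline{\pi}^* )\in\mathcal{R}$ is an extended equilibrium if for every $i\in\{1,\dots,N\}$: $\mathrm{EU}_i(\underline{\sigma}^*;\underline{\pi}^* )\ge\mathrm{EU}_i(a_i|\underline{\sigma}^*;\underline{\pi}^* )$ for all $a_i\in\mathcal{A}_i$, and $\mathrm{ER}_i(\underline{\sigma}^*;\underline{\pi}^* )\ge\mathrm{ER}_i(\theta|\underline{\sigma}^*;\underline{\pi}^* )$ for all $\theta\in\Theta$. *)

theory Defs
  imports "HOL-Analysis.Analysis"
begin

text \<open>The players are \<open>1, \<dots>, N\<close>. Tuples indexed by the players are functions on \<^typ>\<open>nat\<close> that are
  extensional on \<open>{1..N}\<close>, so that \<open>b(i := c)\<close> replaces the entry \<open>i\<close> of the tuple \<open>b\<close>. The action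
  sets of the different players are arbitrary subsets of one common type, which is no restriction
  because they are finite.\<close>

record ('a, 't) game =
  num_players :: nat
  actions :: "nat \<Rightarrow> 'a set"
  parameters :: "'t set"
  utility :: "nat \<Rightarrow> (nat \<Rightarrow> 'a) \<Rightarrow> 't \<Rightarrow> real"

abbreviation players :: "('a, 't) game \<Rightarrow> nat set" where
  "players G \<equiv> {1..num_players G}"

definition game_with_uncertainty :: "('a, 't) game \<Rightarrow> bool" where
  "game_with_uncertainty G \<longleftrightarrow>
     num_players G \<ge> 1 \<and>
     (\<forall>i\<in>players G. finite (actions G i) \<and> actions G i \<noteq> {}) \<and>
     finite (parameters G) \<and> parameters G \<noteq> {}"

definition action_profiles :: "('a, 't) game \<Rightarrow> (nat \<Rightarrow> 'a) set" where
  "action_profiles G = (\<Pi>\<^sub>E i\<in>players G. actions G i)"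

definition Delta :: "'s set \<Rightarrow> ('s \<Rightarrow> real) set" where
  "Delta S = {p \<in> S \<rightarrow>\<^sub>E {0..1}. (\<Sum>s\<in>S. p s) = 1}"

type_synonym ('a, 't) profile = "(nat \<Rightarrow> 'a \<Rightarrow> real) \<times> (nat \<Rightarrow> 't \<Rightarrow> real)"

definition complete_profiles :: "('a, 't) game \<Rightarrow> ('a, 't) profile set" where
  "complete_profiles G =
     (\<Pi>\<^sub>E i\<in>players G. Delta (actions G i)) \<times> (\<Pi>\<^sub>E i\<in>players G. Delta (parameters G))"

definition action_prob :: "('a, 't) game \<Rightarrow> (nat \<Rightarrow> 'a \<Rightarrow> real) \<Rightarrow> (nat \<Rightarrow> 'a) \<Rightarrow> real" where
  "action_prob G \<sigma> a = (\<Prod>j\<in>players G. \<sigma> j (a j))"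

definition joint_prob :: "('a, 't) game \<Rightarrow> nat \<Rightarrow> ('a, 't) profile \<Rightarrow> (nat \<Rightarrow> 'a) \<Rightarrow> 't \<Rightarrow> real" where
  "joint_prob G i \<rho> a \<theta> = (case \<rho> of (\<sigma>, \<pi>) \<Rightarrow> (\<Prod>j\<in>players G. \<sigma> j (a j)) * \<pi> i \<theta>)"

definition regret ::
    "('a, 't) game \<Rightarrow> nat \<Rightarrow> (nat \<Rightarrow> 'a \<Rightarrow> real) \<Rightarrow> (nat \<Rightarrow> 'a) \<Rightarrow> 't \<Rightarrow> real" where
  "regret G i \<sigma> a \<theta> =
     Max ((\<lambda>c. \<Sum>b\<in>action_profiles G. utility G i (b(i := c)) \<theta> * action_prob G \<sigma> b) ` actions G i)
     - utility G i a \<theta>"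

definition EU :: "('a, 't) game \<Rightarrow> nat \<Rightarrow> ('a, 't) profile \<Rightarrow> real" where
  "EU G i \<rho> =
     (\<Sum>(a, \<theta>)\<in>action_profiles G \<times> parameters G. utility G i a \<theta> * joint_prob G i \<rho> a \<theta>)"

definition EU_action :: "('a, 't) game \<Rightarrow> nat \<Rightarrow> 'a \<Rightarrow> ('a, 't) profile \<Rightarrow> real" where
  "EU_action G i c \<rho> =
     (\<Sum>(b, \<theta>)\<in>action_profiles G \<times> parameters G. utility G i (b(i := c)) \<theta> * joint_prob G i \<rho> b \<theta>)"

definition ER :: "('a, 't) game \<Rightarrow> nat \<Rightarrow> ('a, 't) profile \<Rightarrow> real" where
  "ER G i \<rho> =
     (\<Sum>(a, \<theta>)\<in>action_profiles G \<times> parameters G. regret G i (fst \<rho>) a \<theta> * joint_prob G i \<rho> a \<theta>)"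

definition ER_parameter :: "('a, 't) game \<Rightarrow> nat \<Rightarrow> 't \<Rightarrow> ('a, 't) profile \<Rightarrow> real" where
  "ER_parameter G i \<theta> \<rho> =
     (\<Sum>a\<in>action_profiles G. regret G i (fst \<rho>) a \<theta> * action_prob G (fst \<rho>) a)"

definition extended_equilibrium :: "('a, 't) game \<Rightarrow> ('a, 't) profile \<Rightarrow> bool" where
  "extended_equilibrium G \<rho> \<longleftrightarrow>
     \<rho> \<in> complete_profiles G \<and>
     (\<forall>i\<in>players G.
        (\<forall>c\<in>actions G i. EU G i \<rho> \<ge> EU_action G i c \<rho>) \<and>
        (\<forall>\<theta>\<in>parameters G. ER G i \<rho> \<ge> ER_parameter G i \<theta> \<rho>))"

end

theory Submission
  imports Defs
begin

text \<open>A player's regret inequalities say that the prior \<open>\<pi>\<^sub>i\<close> is a best response in a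
  fictitious game where a second copy of player \<open>i\<close> chooses the parameter and is paid the expected
  regret. Extended equilibria are therefore the Nash equilibria of a game with \<open>2 N\<close> agents whose
  payoffs are continuous, though not multilinear, in the mixed profile. Nash's argument still
  applies: a fixed point of the map that shifts weight towards the profitable choices is an
  equilibrium. The cube whose points are mixed profiles has no fixed dimension, so Brouwer's
  theorem is derived for it from Kuhn's combinatorial lemma.\<close>

section \<open>Brouwer's theorem for cubes of variable dimension\<close>

text \<open>Tychonoff: the extensional cube is a product over all indices whose factor at each index
  from \<open>n\<close> on is the compact singleton \<open>{undefined}\<close>.\<close>

lemma compact_PiE_unit_interval:
  "compact ({..<n::nat} \<rightarrow>\<^sub>E {0..1::real})"
proof -
  have "({..<n} \<rightarrow>\<^sub>E {0..1::real}) = (\<Pi>\<^sub>E i\<in>UNIV. if i < n then {0..1} else {undefined})"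
    by (auto simp: PiE_def Pi_def extensional_def split: if_splits)
  moreover have "compactin (product_topology (\<lambda>i. euclidean) UNIV)
      (\<Pi>\<^sub>E i\<in>UNIV. if i < n then {0..1::real} else {undefined})"
    unfolding compactin_PiE by auto
  ultimately show ?thesis
    by (simp add: euclidean_product_topology)
qed

lemma tendsto_coordinatewise_iff:
  fixes g :: "'b \<Rightarrow> 'i \<Rightarrow> 'c::topological_space"
  shows "(g \<longlongrightarrow> l) F \<longleftrightarrow> (\<forall>i. ((\<lambda>x. g x i) \<longlongrightarrow> l i) F)"
  using limitin_componentwise[of "\<lambda>_::'i. euclidean :: 'c topology" UNIV g l F]
  by (simp add: euclidean_product_topology)

text \<open>On ever finer grids Kuhn's lemma finds small cells in which, for each coordinate
  \<open>i\<close>, one point is moved up weakly by \<open>f\<close> and another down. By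
  compactness the cells accumulate at some \<open>x\<close>, where continuity makes both
  inequalities hold, so \<open>f\<close> moves no coordinate of \<open>x\<close>.\<close>

lemma brouwer_nat_cube:
  fixes f :: "(nat \<Rightarrow> real) \<Rightarrow> nat \<Rightarrow> real"
  assumes cont: "continuous_on ({..<n} \<rightarrow>\<^sub>E {0..1}) f"
    and maps: "f \<in> ({..<n} \<rightarrow>\<^sub>E {0..1}) \<rightarrow> ({..<n} \<rightarrow>\<^sub>E {0..1})"
  shows "\<exists>x\<in>{..<n} \<rightarrow>\<^sub>E {0..1}. f x = x"
proof -
  let ?C = "{..<n} \<rightarrow>\<^sub>E {0..1::real}"
  have fC: "x \<in> ?C \<Longrightarrow> f x \<in> ?C" for x
    using maps by (rule funcset_mem)
  have C01: "x \<in> ?C \<Longrightarrow> i < n \<Longrightarrow> 0 \<le> x i \<and> x i \<le> 1" for x i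
    using PiE_mem[of x "{..<n}" "\<lambda>_. {0..1}" i] by simp
  have f01: "0 \<le> f x i \<and> f x i \<le> 1" if "x \<in> ?C" "i < n" for x i
    using C01[OF fC[OF that(1)] that(2)] .
  \<comment> \<open>Label 1 means that coordinate \<open>i\<close> does not increase. Points with
    \<open>x i = 0\<close> get label 0, as Kuhn's boundary condition demands; this is consistent
    because \<open>f x i\<close> cannot be negative there.\<close>
  define l :: "(nat \<Rightarrow> real) \<Rightarrow> nat \<Rightarrow> nat"
    where "l x i = (if x i \<noteq> 0 \<and> f x i \<le> x i then 1 else 0)" for x i
  have l: "l x i \<le> 1" "x i = 0 \<Longrightarrow> l x i = 0" "l x i = 1 \<Longrightarrow> f x i \<le> x i" for x i
    by (simp_all add: l_def split: if_splits)
  have l_1: "l x i = 1" if "x \<in> ?C" "i < n" "x i = 1" for x i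
    using f01[OF that(1,2)] that(3) by (simp add: l_def)
  have l_0: "x i \<le> f x i" if "x \<in> ?C" "i < n" "l x i = 0" for x i
    using f01[OF that(1,2)] that(3) by (cases "x i = 0") (simp_all add: l_def split: if_splits)
  define grid where "grid m q = (\<lambda>i\<in>{..<n}. real (q i) / real (Suc m))" for m and q :: "nat \<Rightarrow> nat"
  have gridC: "grid m q \<in> ?C" if "\<forall>i<n. q i \<le> Suc m" for m q
    using that by (auto simp: grid_def simp del: of_nat_Suc)
  \<comment> \<open>Each mesh width yields a base point with two witnesses nearby for every
    coordinate. The witnesses may differ from one coordinate to the next.\<close>
  have "\<exists>x. x \<in> ?C \<and> (\<forall>i<n. \<exists>r\<in>?C. \<exists>s\<in>?C. (\<forall>j<n. \<bar>r j - x j\<bar> \<le> 1 / real (Suc m)) \<and>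
      (\<forall>j<n. \<bar>s j - x j\<bar> \<le> 1 / real (Suc m)) \<and> r i \<le> f r i \<and> f s i \<le> s i)" for m
  proof -
    obtain q where q: "\<forall>i<n. q i < Suc m"
      and cell: "\<forall>i<n. \<exists>r s. (\<forall>j<n. q j \<le> r j \<and> r j \<le> q j + 1) \<and>
        (\<forall>j<n. q j \<le> s j \<and> s j \<le> q j + 1) \<and> l (grid m r) i \<noteq> l (grid m s) i"
    proof (rule kuhn_lemma[of "Suc m" n "\<lambda>q. l (grid m q)"])
      show "\<forall>x. (\<forall>i<n. x i \<le> Suc m) \<longrightarrow> (\<forall>i<n. l (grid m x) i = 0 \<or> l (grid m x) i = 1)"
        using l(1) by (metis le_eq_less_or_eq less_one)
      show "\<forall>x. (\<forall>i<n. x i \<le> Suc m) \<longrightarrow> (\<forall>i<n. x i = 0 \<longrightarrow> l (grid m x) i = 0)"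
        using l(2) by (simp add: grid_def)
      show "\<forall>x. (\<forall>i<n. x i \<le> Suc m) \<longrightarrow> (\<forall>i<n. x i = Suc m \<longrightarrow> l (grid m x) i = 1)"
        using l_1 gridC by (simp add: grid_def del: of_nat_Suc)
    qed auto
    have near: "\<bar>grid m r j - grid m q j\<bar> \<le> 1 / real (Suc m)"
      if "q j \<le> r j \<and> r j \<le> q j + 1" "j < n" for r j
    proof -
      have "grid m r j - grid m q j = (real (r j) - real (q j)) / real (Suc m)"
        using that(2) by (simp add: grid_def diff_divide_distrib)
      then have "\<bar>grid m r j - grid m q j\<bar> = (real (r j) - real (q j)) / real (Suc m)"
        using that(1) by simp
      also have "\<dots> \<le> 1 / real (Suc m)"
        using that by (intro divide_right_mono) auto
      finally show ?thesis .
    qed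
    \<comment> \<open>The strict bound \<open>q i < Suc m\<close> keeps the far corners
      \<open>q i + 1\<close> inside the grid.\<close>
    have le: "\<forall>j<n. r j \<le> Suc m" if "\<forall>j<n. q j \<le> r j \<and> r j \<le> q j + 1" for r
      using that q by fastforce
    show ?thesis
    proof (intro exI[of _ "grid m q"] conjI allI impI)
      show "grid m q \<in> ?C"
        using q by (intro gridC) auto
      fix i assume i: "i < n"
      from cell i obtain r s where rs: "\<forall>j<n. q j \<le> r j \<and> r j \<le> q j + 1"
        "\<forall>j<n. q j \<le> s j \<and> s j \<le> q j + 1" "l (grid m r) i \<noteq> l (grid m s) i"
        by blast
      have C: "grid m r \<in> ?C" "grid m s \<in> ?C"
        using gridC[OF le[OF rs(1)]] gridC[OF le[OF rs(2)]] .
      have nr: "\<forall>j<n. \<bar>grid m r j - grid m q j\<bar> \<le> 1 / real (Suc m)"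
           and ns: "\<forall>j<n. \<bar>grid m s j - grid m q j\<bar> \<le> 1 / real (Suc m)"
        using near rs(1,2) by simp_all
      \<comment> \<open>Kuhn's lemma only says that the two labels differ; \<open>a\<close> is the
        corner with label 0 and \<open>b\<close> the one with label 1.\<close>
      have "l (grid m r) i = 0 \<and> l (grid m s) i = 1 \<or> l (grid m r) i = 1 \<and> l (grid m s) i = 0"
        using rs(3) l(1)[of "grid m r" i] l(1)[of "grid m s" i] by linarith
      then obtain a b where ab: "a \<in> ?C" "b \<in> ?C" "l a i = 0" "l b i = 1"
          "\<forall>j<n. \<bar>a j - grid m q j\<bar> \<le> 1 / real (Suc m)"
          "\<forall>j<n. \<bar>b j - grid m q j\<bar> \<le> 1 / real (Suc m)"
        using C nr ns by (elim disjE conjE) (rule that; assumption)+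
      show "\<exists>r\<in>?C. \<exists>s\<in>?C. (\<forall>j<n. \<bar>r j - grid m q j\<bar> \<le> 1 / real (Suc m)) \<and>
        (\<forall>j<n. \<bar>s j - grid m q j\<bar> \<le> 1 / real (Suc m)) \<and> r i \<le> f r i \<and> f s i \<le> s i"
        by (intro bexI[of _ a] bexI[of _ b] conjI ab l_0[OF ab(1) i ab(3)] l(3)[OF ab(4)])
    qed
  qed
  then obtain X where X: "\<And>m. X m \<in> ?C" and cells:
    "\<And>m i. i < n \<Longrightarrow> \<exists>r\<in>?C. \<exists>s\<in>?C. (\<forall>j<n. \<bar>r j - X m j\<bar> \<le> 1 / real (Suc m)) \<and>
      (\<forall>j<n. \<bar>s j - X m j\<bar> \<le> 1 / real (Suc m)) \<and> r i \<le> f r i \<and> f s i \<le> s i"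
    by metis
  \<comment> \<open>Compactness gives convergent subsequences because functions on the countable
    type \<open>nat\<close> form a first-countable space.\<close>
  obtain x \<phi> where x: "x \<in> ?C" and \<phi>: "strict_mono \<phi>" and lim: "(X \<circ> \<phi>) \<longlonglongrightarrow> x"
    using compact_imp_seq_compact[OF compact_PiE_unit_interval] X unfolding seq_compact_def by metis
  \<comment> \<open>Any selection of points from the shrinking cells has the same limit as the base
    points; outside \<open>{..<n}\<close> all members of the cube are
    \<open>undefined\<close>.\<close>
  have tendsto_near: "Y \<longlonglongrightarrow> x"
    if Y: "\<And>m. Y m \<in> ?C" "\<And>m. \<forall>j<n. \<bar>Y m j - X (\<phi> m) j\<bar> \<le> 1 / real (Suc (\<phi> m))" for Y
  proof -
    have "(\<lambda>m. Y m j) \<longlonglongrightarrow> x j" for j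
    proof (cases "j < n")
      case True
      have "(\<lambda>m. 1 / real (Suc (\<phi> m))) \<longlonglongrightarrow> 0"
        using LIMSEQ_subseq_LIMSEQ[OF LIMSEQ_inverse_real_of_nat \<phi>]
        by (simp add: o_def inverse_eq_divide)
      then have "(\<lambda>m. Y m j - X (\<phi> m) j) \<longlonglongrightarrow> 0"
        by (rule Lim_null_comparison[rotated]) (use Y(2) True in auto)
      moreover have "(\<lambda>m. X (\<phi> m) j) \<longlonglongrightarrow> x j"
        using lim by (simp add: o_def tendsto_coordinatewise_iff[of _ x])
      ultimately show ?thesis
        using tendsto_add[of "\<lambda>m. Y m j - X (\<phi> m) j" 0] by fastforce
    next
      case False
      then have "Y m j = x j" for m
        using PiE_arb[OF Y(1), of j] PiE_arb[OF x, of j] by simp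
      then show ?thesis by simp
    qed
    then show ?thesis
      by (simp add: tendsto_coordinatewise_iff[of _ x])
  qed
  have lim_f: "(\<lambda>m. f (Y m) i) \<longlonglongrightarrow> f x i"
    if "\<And>m. Y m \<in> ?C" "Y \<longlonglongrightarrow> x" for Y i
    using continuous_on_tendsto_compose[OF continuous_on_product_then_coordinatewise[OF cont] that(2) x]
      that(1) by simp
  have "f x i = x i" for i
  proof (cases "i < n")
    case True
    \<comment> \<open>With \<open>i\<close> fixed, choose in each cell a point moved up and a point
      moved down in that coordinate. The limits of the two inequalities squeeze
      \<open>f x i\<close>.\<close>
    obtain r s where r: "\<And>m. r m \<in> ?C" "\<And>m. \<forall>j<n. \<bar>r m j - X (\<phi> m) j\<bar> \<le> 1 / real (Suc (\<phi> m))"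
        and s: "\<And>m. s m \<in> ?C" "\<And>m. \<forall>j<n. \<bar>s m j - X (\<phi> m) j\<bar> \<le> 1 / real (Suc (\<phi> m))"
        and le: "\<And>m. r m i \<le> f (r m) i" "\<And>m. f (s m) i \<le> s m i"
    proof -
      have "\<forall>m. \<exists>r s. r \<in> ?C \<and> s \<in> ?C \<and> (\<forall>j<n. \<bar>r j - X (\<phi> m) j\<bar> \<le> 1 / real (Suc (\<phi> m))) \<and>
          (\<forall>j<n. \<bar>s j - X (\<phi> m) j\<bar> \<le> 1 / real (Suc (\<phi> m))) \<and> r i \<le> f r i \<and> f s i \<le> s i"
        using cells[OF True] unfolding Bex_def by simp
      then obtain r s where "\<forall>m. r m \<in> ?C \<and> s m \<in> ?C \<and>
          (\<forall>j<n. \<bar>r m j - X (\<phi> m) j\<bar> \<le> 1 / real (Suc (\<phi> m))) \<and>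
          (\<forall>j<n. \<bar>s m j - X (\<phi> m) j\<bar> \<le> 1 / real (Suc (\<phi> m))) \<and> r m i \<le> f (r m) i \<and> f (s m) i \<le> s m i"
        unfolding choice_iff by (elim exE)
      then show ?thesis
        by (intro that[of r s]) simp_all
    qed
    have rx: "r \<longlonglongrightarrow> x" and sx: "s \<longlonglongrightarrow> x"
      using tendsto_near[OF r] tendsto_near[OF s] .
    have ri: "(\<lambda>m. r m i) \<longlonglongrightarrow> x i" and si: "(\<lambda>m. s m i) \<longlonglongrightarrow> x i"
      using rx sx by (simp_all add: tendsto_coordinatewise_iff[of _ x])
    have "x i \<le> f x i"
      using LIMSEQ_le[OF ri lim_f[OF r(1) rx]] le(1) by simp
    moreover have "f x i \<le> x i"
      using LIMSEQ_le[OF lim_f[OF s(1) sx] si] le(2) by simp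
    ultimately show ?thesis by simp
  next
    case False
    then show ?thesis
      using PiE_arb[OF x, of i] PiE_arb[OF fC[OF x], of i] by simp
  qed
  then show ?thesis using x by blast
qed

text \<open>Conjugating \<open>f\<close> with an enumeration of \<open>I\<close> reduces the claim
  to \<open>brouwer_nat_cube\<close>: \<open>h\<close> carries a point of the numbered cube to one
  of the cube over \<open>I\<close>, and \<open>g\<close> is \<open>f\<close> seen in the numbered
  coordinates.\<close>

lemma brouwer_finite_cube:
  fixes f :: "('i \<Rightarrow> real) \<Rightarrow> 'i \<Rightarrow> real"
  assumes "finite I"
    and cont: "continuous_on (I \<rightarrow>\<^sub>E {0..1}) f"
    and maps: "f \<in> (I \<rightarrow>\<^sub>E {0..1}) \<rightarrow> (I \<rightarrow>\<^sub>E {0..1})"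
  shows "\<exists>x\<in>I \<rightarrow>\<^sub>E {0..1}. f x = x"
proof -
  obtain e where e: "bij_betw e {..<card I} I"
    using ex_bij_betw_nat_finite[OF \<open>finite I\<close>] by (auto simp: atLeast0LessThan)
  define d where "d = the_inv_into {..<card I} e"
  have d: "d i < card I" "e (d i) = i" if "i \<in> I" for i
    using that e f_the_inv_into_f_bij_betw[OF e] bij_betwE[OF bij_betw_the_inv_into[OF e]]
    by (auto simp: d_def)
  have ed: "e j \<in> I" "d (e j) = j" if "j < card I" for j
    using that e by (auto simp: d_def bij_betw_def the_inv_into_f_f)
  let ?C = "I \<rightarrow>\<^sub>E {0..1::real}" and ?D = "{..<card I} \<rightarrow>\<^sub>E {0..1::real}"
  define h where "h y = (\<lambda>i\<in>I. y (d i))" for y :: "nat \<Rightarrow> real"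
  define g where "g y = (\<lambda>j\<in>{..<card I}. f (h y) (e j))" for y
  have h: "h \<in> ?D \<rightarrow> ?C"
    using d by (fastforce simp: h_def)
  have cont_h: "continuous_on ?D h"
  proof (rule continuous_on_coordinatewise_then_product)
    fix i
    show "continuous_on ?D (\<lambda>y. h y i)"
      by (cases "i \<in> I") (auto simp: h_def intro: continuous_on_subset[OF continuous_on_product_coordinates])
  qed
  have cont_fh: "continuous_on ?D (\<lambda>y. f (h y))"
    using continuous_on_compose2[OF cont cont_h] h by auto
  have "\<exists>y\<in>?D. g y = y"
  proof (rule brouwer_nat_cube)
    show "continuous_on ?D g"
    proof (rule continuous_on_coordinatewise_then_product)
      fix j
      show "continuous_on ?D (\<lambda>y. g y j)"
        by (cases "j < card I")
          (auto simp: g_def intro: continuous_on_product_then_coordinatewise[OF cont_fh])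
    qed
    show "g \<in> ?D \<rightarrow> ?D"
    proof
      fix y assume "y \<in> ?D"
      then have "f (h y) \<in> ?C"
        by (intro funcset_mem[OF maps] funcset_mem[OF h])
      then show "g y \<in> ?D"
        using ed by (auto simp: g_def PiE_iff)
    qed
  qed
  then obtain y where y: "y \<in> ?D" "g y = y"
    by blast
  have C: "h y \<in> ?C"
    using y(1) by (rule funcset_mem[OF h])
  then have fC: "f (h y) \<in> ?C"
    by (rule funcset_mem[OF maps])
  have "f (h y) i = h y i" for i
  proof (cases "i \<in> I")
    case True
    then have "g y (d i) = f (h y) i"
      using d by (simp add: g_def)
    then show ?thesis
      using True y(2) by (simp add: h_def)
  next
    case False
    then show ?thesis
      using PiE_arb[OF C, of i] PiE_arb[OF fC, of i] by simp
  qed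
  then show ?thesis
    using C by blast
qed

section \<open>Nash equilibria for continuous payoffs\<close>

text \<open>The upper bound 1 is automatic, since a nonnegative entry is at most the total.\<close>

lemma Delta_iff:
  assumes "finite S"
  shows "p \<in> Delta S \<longleftrightarrow> p \<in> extensional S \<and> (\<forall>s\<in>S. 0 \<le> p s) \<and> sum p S = 1"
proof -
  have "p s \<le> 1" if "\<forall>s\<in>S. 0 \<le> p s" "sum p S = 1" "s \<in> S" for s
    using member_le_sum[of s S p] assms that by auto
  then show ?thesis
    by (auto simp: Delta_def PiE_iff)
qed

text \<open>As \<open>u\<close> is the average of \<open>w\<close> under \<open>p\<close>, some
  \<open>t\<close> of positive weight has \<open>w t\<close> at most \<open>u\<close>. Its gain is
  zero, so the fixed-point equation merely divides \<open>p t\<close> by one plus the total gain.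
  Hence the total gain vanishes, and with it every single gain.\<close>

lemma nash_gain_eq_0:
  fixes p w :: "'s \<Rightarrow> real"
  assumes "finite S" and nonneg: "\<And>s. s \<in> S \<Longrightarrow> 0 \<le> p s" and sum1: "sum p S = 1"
    and u: "u = (\<Sum>s\<in>S. p s * w s)"
    and fixed: "\<And>s. s \<in> S \<Longrightarrow>
      p s = (p s + max 0 (w s - u)) / (1 + (\<Sum>t\<in>S. max 0 (w t - u)))"
    and "s \<in> S"
  shows "w s \<le> u"
proof -
  let ?\<Phi> = "\<Sum>t\<in>S. max 0 (w t - u)"
  have \<Phi>: "0 \<le> ?\<Phi>"
    by (intro sum_nonneg) auto
  \<comment> \<open>If every choice of positive weight did better than \<open>u\<close>, so would
    the average.\<close>
  have "\<exists>t\<in>S. p t > 0 \<and> w t \<le> u"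
  proof (rule ccontr)
    assume neg: "\<not> ?thesis"
    then have ge: "p t * u \<le> p t * w t" if "t \<in> S" for t
      using nonneg[OF that] that by (cases "p t = 0") (auto intro: mult_left_mono)
    obtain t where "t \<in> S" "p t \<noteq> 0"
      using sum1 sum.neutral[of S p] by fastforce
    then have t: "t \<in> S" "p t > 0"
      using nonneg[of t] by auto
    then have "p t * u < p t * w t"
      using neg by (auto simp: not_le)
    then have "(\<Sum>t\<in>S. p t * u) < (\<Sum>t\<in>S. p t * w t)"
      using \<open>finite S\<close> ge t by (intro sum_strict_mono_ex1 bexI[of _ t]) auto
    then show False
      using u sum1 by (simp add: sum_distrib_right[symmetric])
  qed
  then obtain t where t: "t \<in> S" "p t > 0" "w t \<le> u"
    by blast
  have "p t = p t / (1 + ?\<Phi>)"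
    using fixed[OF t(1)] t(3) by (simp add: max_absorb1)
  then have "?\<Phi> = 0"
    using t(2) \<Phi> by (simp add: field_simps)
  then have "max 0 (w s - u) = 0"
    using \<open>finite S\<close> \<open>s \<in> S\<close> by (simp add: sum_nonneg_eq_0_iff)
  then show ?thesis by simp
qed

text \<open>Here \<open>v k x p\<close> is what agent \<open>k\<close> gets from the pure choice
  \<open>x\<close> against \<open>p\<close>, with arbitrary continuous dependence on
  \<open>p\<close>. Nash's map composed with a retraction of a cube has a Brouwer fixed point; being
  a value of Nash's map, it is left alone by the retraction.\<close>

theorem nash_continuous_payoffs:
  fixes v :: "'k \<Rightarrow> 'x \<Rightarrow> ('k \<Rightarrow> 'x \<Rightarrow> real) \<Rightarrow> real"
  assumes "finite K" and X: "\<And>k. k \<in> K \<Longrightarrow> finite (X k) \<and> X k \<noteq> {}"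
    and cont: "\<And>k x. k \<in> K \<Longrightarrow> x \<in> X k \<Longrightarrow> continuous_on (\<Pi>\<^sub>E k\<in>K. Delta (X k)) (v k x)"
  shows "\<exists>p\<in>(\<Pi>\<^sub>E k\<in>K. Delta (X k)). \<forall>k\<in>K. \<forall>x\<in>X k. v k x p \<le> (\<Sum>y\<in>X k. p k y * v k y p)"
proof -
  let ?P = "\<Pi>\<^sub>E k\<in>K. Delta (X k)" and ?C = "Sigma K X \<rightarrow>\<^sub>E {0..1::real}"
  \<comment> \<open>A retraction of the cube onto the mixed profiles: missing mass is spread evenly, then normalised.\<close>
  define r where "r z = (\<lambda>k\<in>K. \<lambda>x\<in>X k.
      (z (k, x) + max 0 (1 - (\<Sum>y\<in>X k. z (k, y))) / card (X k)) / max 1 (\<Sum>y\<in>X k. z (k, y)))"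
    for z :: "'k \<times> 'x \<Rightarrow> real"
  have r: "r z \<in> ?P" if z: "z \<in> ?C" for z
  proof (unfold r_def, intro restrict_PiE_iff[THEN iffD2] ballI)
    fix k assume k: "k \<in> K"
    let ?S = "\<Sum>y\<in>X k. z (k, y)"
    let ?q = "\<lambda>x\<in>X k. (z (k, x) + max 0 (1 - ?S) / card (X k)) / max 1 ?S"
    have fin: "finite (X k)" "card (X k) \<noteq> 0"
      using X[OF k] by auto
    have "(\<Sum>x\<in>X k. ?q x) = (?S + max 0 (1 - ?S)) / max 1 ?S"
      using fin by (simp add: sum_divide_distrib[symmetric] sum.distrib)
    \<comment> \<open>If \<open>?S\<close> is at most 1, the added mass completes it to 1 and the
      denominator is 1; otherwise nothing is added and the quotient is
      \<open>?S / ?S\<close>.\<close>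
    also have "\<dots> = 1"
      by (simp add: max_def)
    finally have "sum ?q (X k) = 1" .
    moreover have "0 \<le> ?q x" if x: "x \<in> X k" for x
    proof -
      have "0 \<le> z (k, x)"
        using z k x by (auto dest: PiE_mem)
      then show ?thesis
        using x by simp
    qed
    ultimately show "?q \<in> Delta (X k)"
      using fin by (simp add: Delta_iff)
  qed
  have cont_r: "continuous_on ?C r"
  proof (intro continuous_on_coordinatewise_then_product)
    fix k x
    have coord: "continuous_on ?C (\<lambda>z. z j)" for j
      by (rule continuous_on_subset[OF continuous_on_product_coordinates]) auto
    show "continuous_on ?C (\<lambda>z. r z k x)"
    proof (cases "k \<in> K \<and> x \<in> X k")
      case True
      then have "card (X k) \<noteq> 0" using X by auto
      then show ?thesis
        using True by (auto simp: r_def intro!: continuous_intros coord)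
    qed (cases "k \<in> K"; auto simp: r_def)
  qed
  have fixed_r: "r z k x = z (k, x)" if "(\<Sum>y\<in>X k. z (k, y)) = 1" "k \<in> K" "x \<in> X k" for z k x
    using that by (simp add: r_def)
  define u where "u p k = (\<Sum>y\<in>X k. p k y * v k y p)" for p k
  define \<Phi> where "\<Phi> p k = (\<Sum>y\<in>X k. max 0 (v k y p - u p k))" for p k
  \<comment> \<open>Nash's map: every choice gains weight by its advantage over the current average
    \<open>u p k\<close>, then the weights are renormalised. Values are indexed by pairs so that
    they lie in the cube.\<close>
  define N where "N p = (\<lambda>(k, x)\<in>Sigma K X. (p k x + max 0 (v k x p - u p k)) / (1 + \<Phi> p k))" for p
  have \<Phi>: "0 \<le> \<Phi> p k" for p k
    unfolding \<Phi>_def by (intro sum_nonneg) auto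
  have P: "0 \<le> p k x" "sum (p k) (X k) = 1" if "p \<in> ?P" "k \<in> K" "x \<in> X k" for p k x
    using PiE_mem[OF that(1,2)] X[OF that(2)] that(3) by (auto simp: Delta_iff)
  have sum_N: "(\<Sum>x\<in>X k. N p (k, x)) = 1" if "p \<in> ?P" "k \<in> K" for p k
  proof -
    have "sum (p k) (X k) = 1"
      using P that X by (metis ex_in_conv)
    then have "(\<Sum>x\<in>X k. N p (k, x)) = (1 + \<Phi> p k) / (1 + \<Phi> p k)"
      using that by (simp add: N_def sum_divide_distrib[symmetric] sum.distrib \<Phi>_def)
    then show ?thesis
      using \<Phi>[of p k] by simp
  qed
  have N: "N p \<in> ?C" if "p \<in> ?P" for p
  proof -
    have nonneg: "0 \<le> N p (k, x)" if "k \<in> K" "x \<in> X k" for k x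
      using P(1)[OF \<open>p \<in> ?P\<close> that] \<Phi>[of p k] that by (simp add: N_def)
    moreover have "N p (k, x) \<le> 1" if "k \<in> K" "x \<in> X k" for k x
      using member_le_sum[of x "X k" "\<lambda>x. N p (k, x)"] nonneg X sum_N[OF \<open>p \<in> ?P\<close>] that by simp
    ultimately show ?thesis
      by (auto simp: PiE_iff) (auto simp: N_def)
  qed
  have cont_N: "continuous_on ?P N"
  proof (intro continuous_on_coordinatewise_then_product)
    fix j
    have coord: "continuous_on ?P (\<lambda>p. p k x)" for k x
      by (rule continuous_on_product_then_coordinatewise,
          rule continuous_on_subset[OF continuous_on_product_coordinates]) auto
    show "continuous_on ?P (\<lambda>p. N p j)"
    proof (cases "j \<in> Sigma K X")
      case True
      then obtain k x where j: "j = (k, x)" "k \<in> K" "x \<in> X k"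
        by auto
      have cont_u: "continuous_on ?P (\<lambda>p. u p k)"
        unfolding u_def by (intro continuous_intros coord cont j)
      have cont_max: "continuous_on ?P (\<lambda>p. max 0 (v k y p - u p k))" if "y \<in> X k" for y
        by (intro continuous_intros cont_u cont j that)
      have "continuous_on ?P (\<lambda>p. \<Phi> p k)"
        unfolding \<Phi>_def by (intro continuous_on_sum cont_max)
      moreover have "1 + \<Phi> p k \<noteq> 0" for p
        using \<Phi>[of p k] by linarith
      ultimately show ?thesis
        using j by (auto simp: N_def intro!: continuous_intros coord cont_max)
    qed (simp add: N_def)
  qed
  have "\<exists>z\<in>?C. N (r z) = z"
  proof (rule brouwer_finite_cube)
    show "finite (Sigma K X)"
      using \<open>finite K\<close> X by blast
    show "continuous_on ?C (\<lambda>z. N (r z))"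
      using continuous_on_compose2[OF cont_N cont_r] r by auto
  qed (use N r in auto)
  then obtain z where z: "z \<in> ?C" "N (r z) = z"
    by blast
  define p where "p = r z"
  have p: "p \<in> ?P"
    using r z p_def by blast
  \<comment> \<open>As a value of \<open>N\<close>, the point \<open>z\<close> has total mass 1 in
    each block, so \<open>r\<close> does not alter it there and \<open>p\<close> is fixed by Nash's
    map.\<close>
  have pz: "p k x = z (k, x)" if "k \<in> K" "x \<in> X k" for k x
    using fixed_r[of z k x] sum_N[OF p that(1)] z(2) that by (simp add: p_def)
  have "v k x p \<le> u p k" if k: "k \<in> K" and x: "x \<in> X k" for k x
  proof (rule nash_gain_eq_0[where S = "X k" and p = "p k" and w = "\<lambda>y. v k y p"])
    fix y assume y: "y \<in> X k"
    have "p k y = N p (k, y)"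
      using pz[OF k y] z(2) by (simp add: p_def)
    then show "p k y = (p k y + max 0 (v k y p - u p k)) / (1 + (\<Sum>t\<in>X k. max 0 (v k t p - u p k)))"
      using k y by (simp add: N_def \<Phi>_def)
  qed (use p P k x X in \<open>auto simp: u_def\<close>)
  then show ?thesis
    using p by (auto simp: u_def)
qed

section \<open>Expected utilities and regrets\<close>

lemma continuous_on_Max_image:
  fixes f :: "'c \<Rightarrow> 'b::topological_space \<Rightarrow> 'd::linorder_topology"
  assumes "finite A" "A \<noteq> {}" "\<And>a. a \<in> A \<Longrightarrow> continuous_on S (f a)"
  shows "continuous_on S (\<lambda>x. Max ((\<lambda>a. f a x) ` A))"
  using assms
proof (induction A rule: finite_ne_induct)
  case (insert a A)
  then have "continuous_on S (\<lambda>x. max (f a x) (Max ((\<lambda>a. f a x) ` A)))"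
    by (intro continuous_on_max) auto
  then show ?case
    using insert.hyps by simp
qed simp

lemma sum_PiE_insert:
  assumes "i \<notin> J"
  shows "(\<Sum>a\<in>Pi\<^sub>E (insert i J) A. h a) = (\<Sum>c\<in>A i. \<Sum>g\<in>Pi\<^sub>E J A. h (g(i := c)))"
proof -
  have "(\<Sum>a\<in>Pi\<^sub>E (insert i J) A. h a) = (\<Sum>(c, g)\<in>A i \<times> Pi\<^sub>E J A. h (g(i := c)))"
    unfolding PiE_insert_eq using inj_combinator[OF assms, of A]
    by (subst sum.reindex) (auto simp: case_prod_beta o_def)
  then show ?thesis
    by (simp add: sum.cartesian_product)
qed

text \<open>By independence the expectation can be conditioned on the action of player
  \<open>i\<close>. In the inner sum on the right the sampled entry \<open>i\<close> is overwritten
  by \<open>c\<close>, so its own probabilities only contribute the factor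
  \<open>sum (\<sigma> i) (actions G i) = 1\<close>.\<close>

lemma sum_action_prob_deviation:
  assumes i: "i \<in> players G" and sum1: "sum (\<sigma> i) (actions G i) = 1"
  shows "(\<Sum>a\<in>action_profiles G. f a * action_prob G \<sigma> a) =
    (\<Sum>c\<in>actions G i. \<sigma> i c * (\<Sum>b\<in>action_profiles G. f (b(i := c)) * action_prob G \<sigma> b))"
proof -
  define J where "J = players G - {i}"
  define w where "w g = (\<Prod>j\<in>J. \<sigma> j (g j))" for g
  have J: "players G = insert i J" "i \<notin> J" "finite J"
    using i by (auto simp: J_def)
  have prob: "action_prob G \<sigma> (g(i := c)) = \<sigma> i c * w g" for g c
  proof -
    have "(\<Prod>j\<in>J. \<sigma> j ((g(i := c)) j)) = w g"
      unfolding w_def using J(2) by (intro prod.cong) auto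
    then show ?thesis
      using J by (simp add: action_prob_def)
  qed
  have split: "(\<Sum>a\<in>action_profiles G. h a * action_prob G \<sigma> a) =
      (\<Sum>c\<in>actions G i. \<sigma> i c * (\<Sum>g\<in>Pi\<^sub>E J (actions G). h (g(i := c)) * w g))" for h
    unfolding action_profiles_def J(1) sum_PiE_insert[OF J(2)]
    by (simp add: prob sum_distrib_left mult_ac)
  \<comment> \<open>Rewriting with \<open>split\<close> acts on both sides, on the right with
    \<open>h\<close> taken to be the function \<open>f (b(i := c))\<close> of
    \<open>b\<close>.\<close>
  show ?thesis
    unfolding split using sum1 by (simp add: sum_distrib_right[symmetric])
qed

lemma joint_prob_eq: "joint_prob G i \<rho> a \<theta> = action_prob G (fst \<rho>) a * snd \<rho> i \<theta>"
  by (simp add: joint_prob_def action_prob_def case_prod_beta)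

lemma EU_eq_sum_EU_action:
  assumes "i \<in> players G" "sum (fst \<rho> i) (actions G i) = 1"
  shows "EU G i \<rho> = (\<Sum>c\<in>actions G i. fst \<rho> i c * EU_action G i c \<rho>)"
proof -
  \<comment> \<open>Averaging over the parameter first leaves a function of the action profile
    alone, to which conditioning on player \<open>i\<close> applies.\<close>
  let ?f = "\<lambda>a. \<Sum>\<theta>\<in>parameters G. utility G i a \<theta> * snd \<rho> i \<theta>"
  have "EU G i \<rho> = (\<Sum>a\<in>action_profiles G. ?f a * action_prob G (fst \<rho>) a)"
    unfolding EU_def joint_prob_eq sum.cartesian_product[symmetric]
    by (simp add: sum_distrib_left sum_distrib_right mult_ac)
  also have "\<dots> = (\<Sum>c\<in>actions G i. fst \<rho> i c *
      (\<Sum>b\<in>action_profiles G. ?f (b(i := c)) * action_prob G (fst \<rho>) b))"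
    by (rule sum_action_prob_deviation[of i G "fst \<rho>" ?f, OF assms])
  also have "\<dots> = (\<Sum>c\<in>actions G i. fst \<rho> i c * EU_action G i c \<rho>)"
    unfolding EU_action_def joint_prob_eq sum.cartesian_product[symmetric]
    by (simp add: sum_distrib_left sum_distrib_right mult_ac)
  finally show ?thesis .
qed

text \<open>Regret depends on the mixed strategies but not on the priors, so expected regret is
  linear in the prior of player \<open>i\<close>. This makes the parameter a pure choice with payoff
  \<open>ER_parameter\<close>.\<close>

lemma ER_eq_sum_ER_parameter:
  "ER G i \<rho> = (\<Sum>\<theta>\<in>parameters G. snd \<rho> i \<theta> * ER_parameter G i \<theta> \<rho>)"
proof -
  have "ER G i \<rho> = (\<Sum>\<theta>\<in>parameters G. \<Sum>a\<in>action_profiles G.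
      regret G i (fst \<rho>) a \<theta> * joint_prob G i \<rho> a \<theta>)"
    unfolding ER_def sum.cartesian_product[symmetric] by (rule sum.swap)
  then show ?thesis
    by (simp add: joint_prob_eq ER_parameter_def sum_distrib_left mult_ac)
qed

lemma continuous_on_EU_action:
  fixes \<rho> :: "'b::topological_space \<Rightarrow> ('a, 't) profile"
  assumes "\<And>j c. continuous_on S (\<lambda>p. fst (\<rho> p) j c)" "\<And>j \<theta>. continuous_on S (\<lambda>p. snd (\<rho> p) j \<theta>)"
  shows "continuous_on S (\<lambda>p. EU_action G i c (\<rho> p))"
  unfolding EU_action_def joint_prob_eq action_prob_def case_prod_beta
  by (intro continuous_intros assms)

text \<open>The payoff is built by sums and products from strategy entries and a maximum over
  finitely many deviations; the maximum keeps continuity though it destroys multilinearity.\<close>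

lemma continuous_on_ER_parameter:
  fixes \<rho> :: "'b::topological_space \<Rightarrow> ('a, 't) profile"
  assumes "\<And>j c. continuous_on S (\<lambda>p. fst (\<rho> p) j c)"
    and "finite (actions G i)" "actions G i \<noteq> {}"
  shows "continuous_on S (\<lambda>p. ER_parameter G i \<theta> (\<rho> p))"
  unfolding ER_parameter_def regret_def action_prob_def
  by (intro continuous_intros continuous_on_Max_image assms)

section \<open>Existence of an extended equilibrium\<close>

theorem theorem4p1:
  fixes G :: "('a, 't) game"
  assumes "game_with_uncertainty G"
  shows "\<exists>\<rho>\<in>complete_profiles G. extended_equilibrium G \<rho>"
proof -
  have A: "finite (actions G i)" "actions G i \<noteq> {}" if "i \<in> players G" for i
    using assms that by (auto simp: game_with_uncertainty_def)
  have T: "finite (parameters G)" "parameters G \<noteq> {}"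
    using assms by (auto simp: game_with_uncertainty_def)
  \<comment> \<open>Agent \<open>Inl i\<close> picks an action for player \<open>i\<close>, and
    agent \<open>Inr i\<close> picks the parameter behind that player's prior. Tagging puts both
    kinds of choices into one type.\<close>
  define K :: "(nat + nat) set" where "K = players G <+> players G"
  define X :: "nat + nat \<Rightarrow> ('a + 't) set"
    where "X = case_sum (\<lambda>i. Inl ` actions G i) (\<lambda>i. Inr ` parameters G)"
  \<comment> \<open>Restriction supplies the extensionality that \<open>complete_profiles\<close>
    requires.\<close>
  define \<rho> :: "(nat + nat \<Rightarrow> 'a + 't \<Rightarrow> real) \<Rightarrow> ('a, 't) profile"
    where "\<rho> p = ((\<lambda>i\<in>players G. \<lambda>c\<in>actions G i. p (Inl i) (Inl c)),
                   (\<lambda>i\<in>players G. \<lambda>\<theta>\<in>parameters G. p (Inr i) (Inr \<theta>)))" for p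
  define v :: "nat + nat \<Rightarrow> 'a + 't \<Rightarrow> (nat + nat \<Rightarrow> 'a + 't \<Rightarrow> real) \<Rightarrow> real"
    where "v k x p = (case k of
        Inl i \<Rightarrow> EU_action G i (projl x) (\<rho> p) | Inr i \<Rightarrow> ER_parameter G i (projr x) (\<rho> p))" for k x p
  let ?P = "\<Pi>\<^sub>E k\<in>K. Delta (X k)"
  have coord: "continuous_on ?P (\<lambda>p. p k x)" for k x
    by (rule continuous_on_product_then_coordinatewise,
        rule continuous_on_subset[OF continuous_on_product_coordinates]) auto
  have cont_\<sigma>: "continuous_on ?P (\<lambda>p. fst (\<rho> p) j c)" for j c
    by (cases "j \<in> players G"; cases "c \<in> actions G j"; auto simp: \<rho>_def intro: coord)
  have cont_\<pi>: "continuous_on ?P (\<lambda>p. snd (\<rho> p) j \<theta>)" for j \<theta>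
    by (cases "j \<in> players G"; cases "\<theta> \<in> parameters G"; auto simp: \<rho>_def intro: coord)
  have finX: "finite (X k) \<and> X k \<noteq> {}" if "k \<in> K" for k
    using that A T by (auto simp: K_def X_def)
  have "\<exists>p\<in>?P. \<forall>k\<in>K. \<forall>x\<in>X k. v k x p \<le> (\<Sum>y\<in>X k. p k y * v k y p)"
  proof (rule nash_continuous_payoffs)
    show "finite K"
      by (simp add: K_def)
    show "continuous_on ?P (v k x)" if "k \<in> K" for k x
    proof (cases k)
      case (Inl i)
      show ?thesis
        unfolding v_def Inl sum.case by (intro continuous_on_EU_action cont_\<sigma> cont_\<pi>)
    next
      case (Inr i)
      then have "i \<in> players G"
        using that by (auto simp: K_def)
      then show ?thesis
        unfolding v_def Inr sum.case by (intro continuous_on_ER_parameter cont_\<sigma> A)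
    qed
  qed (use finX in auto)
  then obtain p where p: "p \<in> ?P"
    and best: "\<And>k x. k \<in> K \<Longrightarrow> x \<in> X k \<Longrightarrow> v k x p \<le> (\<Sum>y\<in>X k. p k y * v k y p)"
    by blast
  have pk: "(\<forall>x\<in>X k. 0 \<le> p k x) \<and> sum (p k) (X k) = 1" if "k \<in> K" for k
    using PiE_mem[OF p that] finX[OF that] by (simp add: Delta_iff)
  have K: "Inl i \<in> K" "Inr i \<in> K" if "i \<in> players G" for i
    using that by (auto simp: K_def)
  have \<sigma>: "fst (\<rho> p) i \<in> Delta (actions G i)" if "i \<in> players G" for i
    using pk[OF K(1)[OF that]] A[OF that] that
    by (auto simp: Delta_iff \<rho>_def X_def sum.reindex)
  have \<pi>: "snd (\<rho> p) i \<in> Delta (parameters G)" if "i \<in> players G" for i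
    using pk[OF K(2)[OF that]] T that
    by (auto simp: Delta_iff \<rho>_def X_def sum.reindex)
  have "\<rho> p \<in> complete_profiles G"
    using \<sigma> \<pi> by (auto simp: complete_profiles_def PiE_iff mem_Times_iff) (auto simp: \<rho>_def)
  moreover have "EU_action G i c (\<rho> p) \<le> EU G i (\<rho> p)"
    if i: "i \<in> players G" and c: "c \<in> actions G i" for i c
  proof -
    \<comment> \<open>The equilibrium inequality of agent \<open>Inl i\<close>, with its sum
      reindexed along \<open>Inl\<close>; the mixture on the right then turns out to be
      \<open>EU\<close>. The regret inequality follows likewise from agent
      \<open>Inr i\<close>.\<close>
    have "EU_action G i c (\<rho> p) \<le> (\<Sum>c\<in>actions G i. p (Inl i) (Inl c) * EU_action G i c (\<rho> p))"
      using best[OF K(1)[OF i], of "Inl c"] c by (simp add: X_def v_def sum.reindex)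
    also have "\<dots> = (\<Sum>c\<in>actions G i. fst (\<rho> p) i c * EU_action G i c (\<rho> p))"
      using i by (intro sum.cong) (auto simp: \<rho>_def)
    also have "\<dots> = EU G i (\<rho> p)"
      using \<sigma>[OF i] A[OF i] i by (subst EU_eq_sum_EU_action) (auto simp: Delta_iff)
    finally show ?thesis .
  qed
  moreover have "ER_parameter G i \<theta> (\<rho> p) \<le> ER G i (\<rho> p)"
    if i: "i \<in> players G" and \<theta>: "\<theta> \<in> parameters G" for i \<theta>
  proof -
    have "ER_parameter G i \<theta> (\<rho> p) \<le>
        (\<Sum>\<theta>\<in>parameters G. p (Inr i) (Inr \<theta>) * ER_parameter G i \<theta> (\<rho> p))"
      using best[OF K(2)[OF i], of "Inr \<theta>"] \<theta> by (simp add: X_def v_def sum.reindex)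
    also have "\<dots> = (\<Sum>\<theta>\<in>parameters G. snd (\<rho> p) i \<theta> * ER_parameter G i \<theta> (\<rho> p))"
      using i by (intro sum.cong) (auto simp: \<rho>_def)
    also have "\<dots> = ER G i (\<rho> p)"
      by (simp add: ER_eq_sum_ER_parameter)
    finally show ?thesis .
  qed
  ultimately show ?thesis
    unfolding extended_equilibrium_def by blast
qed

end
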